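(* Any isoparametric string of the first class is congruent to a symmetrical configuration of the first kind. That is, if $\gamma$ is (a natural parametrization of) an isoparametric string of the first class, there exist $A\in G$ and $(r,\rho)\in\mathfrak A$ with $r\in\mathbb Q$ such that $A\gamma$ is the symmetrical configuration $\gamma_{r,\rho}$ of the first kind, up to a shift of the natural parameter.
   Context: $\mathbb C^{2,1}$ is $\mathbb C^3$ with the Hermitian form $\langle \mathbf z,\mathbf w\rangle={}^t\overline{\mathbf z}\,\mathbf h\,\mathbf w$, $\mathbf h=\begin{pmatrix}0&0&i\\0&1&0\\-i&0&0\end{pmatrix}$. $\mathcal N$ is the set of nonzero null vectors, $\mathcal S=\{[\mathbf z]\in\mathbb{CP}^2:\langle\mathbf z,\mathbf z\rangle=0\}$. $G=\{A\in SL(3,\mathbb C):{}^t\bar A\mathbf hA=\mathbf h\}$ acts on $\mathcal S$ by $A[\mathbf z]=[A\mathbf z]$; curves are congruent if related by an element of $G$. Curves. A lift of a smooth curve $\gamma:\mathbb R\to\mathcal S$ is a smooth $\Gamma:\mathbb R\to\mathcal N$ with $\gamma=[\Gamma]$. $\gamma$ is (positively parametrized) transversal if $-i\langle\Gamma,\Gamma'\rangle>0$, and generic if $\det(\Gamma,\Gamma',\Gamma'')$ never vanishes. A Wilczynski lift has $\det(\Gamma,\Gamma',\Gamma'')=-1$; the parametrization is natural if moreover $i\langle\Gamma,\Gamma'\rangle^{-1}=1$, and then bending and twist are $\kappa=\frac12\langle\Gamma',\Gamma'\rangle$, $\tau=\mathrm{Im}\langle\Gamma'',\Gamma'\rangle+3\kappa^2$.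 A generic transversal curve is isoparametric if $\kappa,\tau$ are constant; an isoparametric string is a closed (periodic) isoparametric curve. For isoparametric strings the discriminant $D_{\kappa,\tau}=-27+108\kappa(\kappa^2+\tau)-324\kappa^4\tau-72\kappa^2\tau^2-4\tau^3$ of the characteristic polynomial of $\mathrm H_{\kappa,\tau}=i\begin{pmatrix}i\kappa&-i&\tau\\0&-2i\kappa&1\\1&0&i\kappa\end{pmatrix}$ is positive, and the spectral ratio $e_1/e_3$ of its eigenvalues $e_1<e_2<e_3$ lies in $(-2,-1/2)\cap\mathbb Q$. The string is of the first class if $3\kappa>|\tau|^{1/2}$, of the second class if $3\kappa<|\tau|^{1/2}$. Symmetrical configurations of the first kind. Let $$\mathfrak A=\Big\{(r,\rho)\in(-2,-\tfrac12)\times(0,\sqrt2):\rho<\sqrt{\tfrac{2(-3+2\sqrt{2-r-r^2})}{1+2r}}\Big\},$$ $$\mu_1(r,\rho)=\frac{4+8r+12\rho^2+(1+2r)\rho^4}{4+8r+12\rho^2+(1+2r)\rho^4-2\big((2+3r-3r^2-2r^3)(-4\rho+\rho^5)\big)^{2/3}}\in(0,1),$$ $e_1^1=r\frac{\mu_1}{1-\mu_1}$, $e_1^2=-(1+r)\frac{\mu_1}{1-\mu_1}$, $e_1^3=\frac{\mu_1}{1-\mu_1}$, $D_1(r,\rho)=\mathrm{diag}(-ie_1^2,-ie_1^3,-ie_1^1)$, $\mathcal U=\begin{pmatrix}\frac1{\sqrt2}&0&\frac i{\sqrt2}\\0&1&0\\\frac i{\sqrt2}&0&\frac1{\sqrt2}\end{pmatrix}$,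 $S(\rho)=[{}^t(1,\rho,i\rho^2/2)]\in\mathcal S$. For $(r,\rho)\in\mathfrak A$, $r\in\mathbb Q$, the symmetrical configuration of the first kind with parameters $(r,\rho)$ is $\gamma_{r,\rho}(s)=\big(\mathcal U\exp(sD_1(r,\rho))\,\mathcal U^{-1}\big)S(\rho)$. *)

theory Defs
  imports "HOL-Analysis.Analysis"
begin

definition hmat :: "complex^3^3" where
  "hmat = vector [vector [0, 0, \<i>],
                  vector [0, 1, 0],
                  vector [- \<i>, 0, 0]]"

definition herm :: "complex^3 \<Rightarrow> complex^3 \<Rightarrow> complex" where
  "herm z w = (\<Sum>j\<in>UNIV. cnj (z $ j) * (hmat *v w) $ j)"

definition conj_transpose :: "complex^3^3 \<Rightarrow> complex^3^3" where
  "conj_transpose A = (\<chi> i j. cnj (A $ j $ i))"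

definition SU21 :: "(complex^3^3) set" where
  "SU21 = {A. det A = 1 \<and> conj_transpose A ** hmat ** A = hmat}"

definition null_cone :: "(complex^3) set" where
  "null_cone = {z. z \<noteq> 0 \<and> herm z z = 0}"

text \<open>A point of the complex projective plane is the complex line through the origin that
  represents it.\<close>

type_synonym proj_point = "(complex^3) set"

definition proj :: "complex^3 \<Rightarrow> proj_point" where
  "proj z = vec.span {z}"

definition sphere_S :: "proj_point set" where
  "sphere_S = proj ` null_cone"

definition proj_act :: "complex^3^3 \<Rightarrow> proj_point \<Rightarrow> proj_point" where
  "proj_act A p = (\<lambda>z. A *v z) ` p"

definition dds :: "(real \<Rightarrow> complex^3) \<Rightarrow> real \<Rightarrow> complex^3" where
  "dds \<Gamma> = (\<lambda>s. vector_derivative \<Gamma> (at s))"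

definition smooth :: "(real \<Rightarrow> complex^3) \<Rightarrow> bool" where
  "smooth \<Gamma> \<longleftrightarrow> (\<forall>n s. (dds ^^ n) \<Gamma> differentiable (at s))"

definition lift_of :: "(real \<Rightarrow> proj_point) \<Rightarrow> (real \<Rightarrow> complex^3) \<Rightarrow> bool" where
  "lift_of \<gamma> \<Gamma> \<longleftrightarrow> smooth \<Gamma> \<and> (\<forall>s. \<Gamma> s \<in> null_cone \<and> \<gamma> s = proj (\<Gamma> s))"

text \<open>A curve in the sphere defined on the whole real line is smooth iff it has a smooth lift,
  because the tautological bundle is trivial over the line.\<close>

definition smooth_curve :: "(real \<Rightarrow> proj_point) \<Rightarrow> bool" where
  "smooth_curve \<gamma> \<longleftrightarrow> range \<gamma> \<subseteq> sphere_S \<and> (\<exists>\<Gamma>. lift_of \<gamma> \<Gamma>)"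

definition frame_det :: "(real \<Rightarrow> complex^3) \<Rightarrow> real \<Rightarrow> complex" where
  "frame_det \<Gamma> s = det (transpose (vector [\<Gamma> s, dds \<Gamma> s, dds (dds \<Gamma>) s]))"

text \<open>For a lift, differentiating \<open>herm (\<Gamma> s) (\<Gamma> s) = 0\<close> shows that the number compared with
  0 in the next definition is real, so taking the real part loses nothing.  The conditions
  \<open>transversal\<close> and \<open>generic\<close> do not depend on the lift.\<close>

definition transversal :: "(real \<Rightarrow> proj_point) \<Rightarrow> bool" where
  "transversal \<gamma> \<longleftrightarrow> smooth_curve \<gamma> \<and>
     (\<forall>\<Gamma>. lift_of \<gamma> \<Gamma> \<longrightarrow> (\<forall>s. Re (- \<i> * herm (\<Gamma> s) (dds \<Gamma> s)) > 0))"

definition generic :: "(real \<Rightarrow> proj_point) \<Rightarrow> bool" where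
  "generic \<gamma> \<longleftrightarrow> smooth_curve \<gamma> \<and>
     (\<forall>\<Gamma>. lift_of \<gamma> \<Gamma> \<longrightarrow> (\<forall>s. frame_det \<Gamma> s \<noteq> 0))"

definition wilczynski_lift :: "(real \<Rightarrow> proj_point) \<Rightarrow> (real \<Rightarrow> complex^3) \<Rightarrow> bool" where
  "wilczynski_lift \<gamma> \<Gamma> \<longleftrightarrow> lift_of \<gamma> \<Gamma> \<and> (\<forall>s. frame_det \<Gamma> s = - 1)"

definition natural_lift :: "(real \<Rightarrow> proj_point) \<Rightarrow> (real \<Rightarrow> complex^3) \<Rightarrow> bool" where
  "natural_lift \<gamma> \<Gamma> \<longleftrightarrow> wilczynski_lift \<gamma> \<Gamma> \<and>
     (\<forall>s. \<i> * inverse (herm (\<Gamma> s) (dds \<Gamma> s)) = 1)"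

text \<open>Since the form is Hermitian, the product in \<open>bending\<close> is real.\<close>

definition bending :: "(real \<Rightarrow> complex^3) \<Rightarrow> real \<Rightarrow> real" where
  "bending \<Gamma> s = 1 / 2 * Re (herm (dds \<Gamma> s) (dds \<Gamma> s))"

definition twist :: "(real \<Rightarrow> complex^3) \<Rightarrow> real \<Rightarrow> real" where
  "twist \<Gamma> s = Im (herm (dds (dds \<Gamma>) s) (dds \<Gamma> s)) + 3 * (bending \<Gamma> s)\<^sup>2"

text \<open>A Wilczynski lift is unique up to a constant cube root of unity, which changes neither
  bending nor twist; so the choice of the natural lift below is immaterial.\<close>

definition isoparametric :: "(real \<Rightarrow> proj_point) \<Rightarrow> real \<Rightarrow> real \<Rightarrow> bool" where
  "isoparametric \<gamma> \<kappa> \<tau> \<longleftrightarrow> transversal \<gamma> \<and> generic \<gamma> \<and>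
     (\<exists>\<Gamma>. natural_lift \<gamma> \<Gamma> \<and> (\<forall>s. bending \<Gamma> s = \<kappa> \<and> twist \<Gamma> s = \<tau>))"

definition closed_curve :: "(real \<Rightarrow> proj_point) \<Rightarrow> bool" where
  "closed_curve \<gamma> \<longleftrightarrow> (\<exists>\<omega>>0. \<forall>s. \<gamma> (s + \<omega>) = \<gamma> s)"

definition isoparametric_string :: "(real \<Rightarrow> proj_point) \<Rightarrow> real \<Rightarrow> real \<Rightarrow> bool" where
  "isoparametric_string \<gamma> \<kappa> \<tau> \<longleftrightarrow> isoparametric \<gamma> \<kappa> \<tau> \<and> closed_curve \<gamma>"

definition first_class_string :: "(real \<Rightarrow> proj_point) \<Rightarrow> bool" where
  "first_class_string \<gamma> \<longleftrightarrow>
     (\<exists>\<kappa> \<tau>. isoparametric_string \<gamma> \<kappa> \<tau> \<and> 3 * \<kappa> > sqrt \<bar>\<tau>\<bar>)"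

definition region_A :: "(real \<times> real) set" where
  "region_A = {(r, \<rho>). - 2 < r \<and> r < - 1 / 2 \<and> 0 < \<rho> \<and> \<rho> < sqrt 2 \<and>
     \<rho> < sqrt (2 * (- 3 + 2 * sqrt (2 - r - r\<^sup>2)) / (1 + 2 * r))}"

definition mu1 :: "real \<Rightarrow> real \<Rightarrow> real" where
  "mu1 r \<rho> =
     (4 + 8 * r + 12 * \<rho>^2 + (1 + 2 * r) * \<rho>^4) /
     (4 + 8 * r + 12 * \<rho>^2 + (1 + 2 * r) * \<rho>^4
       - 2 * ((2 + 3 * r - 3 * r^2 - 2 * r^3) * (- 4 * \<rho> + \<rho>^5)) powr (2 / 3))"

definition e11 :: "real \<Rightarrow> real \<Rightarrow> real" where
  "e11 r \<rho> = r * (mu1 r \<rho> / (1 - mu1 r \<rho>))"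

definition e12 :: "real \<Rightarrow> real \<Rightarrow> real" where
  "e12 r \<rho> = - (1 + r) * (mu1 r \<rho> / (1 - mu1 r \<rho>))"

definition e13 :: "real \<Rightarrow> real \<Rightarrow> real" where
  "e13 r \<rho> = mu1 r \<rho> / (1 - mu1 r \<rho>)"

definition D1 :: "real \<Rightarrow> real \<Rightarrow> complex^3^3" where
  "D1 r \<rho> = vector [vector [- \<i> * of_real (e12 r \<rho>), 0, 0],
                     vector [0, - \<i> * of_real (e13 r \<rho>), 0],
                     vector [0, 0, - \<i> * of_real (e11 r \<rho>)]]"

definition Umat :: "complex^3^3" where
  "Umat = vector [vector [1 / of_real (sqrt 2), 0, \<i> / of_real (sqrt 2)],
                  vector [0, 1, 0],
                  vector [\<i> / of_real (sqrt 2), 0, 1 / of_real (sqrt 2)]]"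

text \<open>Matrices of type \<open>complex^3^3\<close> are not an instance of a normed algebra class, so the
  library function \<open>exp\<close> does not apply to them.\<close>

definition mat_exp :: "complex^3^3 \<Rightarrow> complex^3^3" where
  "mat_exp A = (\<Sum>n. (((**) A) ^^ n) (mat 1) /\<^sub>R fact n)"

definition S_point :: "real \<Rightarrow> proj_point" where
  "S_point \<rho> = proj (vector [1, of_real \<rho>, \<i> * of_real (\<rho>\<^sup>2) / 2])"

definition symm_config1 :: "real \<Rightarrow> real \<Rightarrow> real \<Rightarrow> proj_point" where
  "symm_config1 r \<rho> s =
     proj_act (Umat ** mat_exp (s *\<^sub>R D1 r \<rho>) ** matrix_inv Umat) (S_point \<rho>)"

end

theory Submission
  imports Defs "HOL-Computational_Algebra.Fundamental_Theorem_Algebra"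
begin

text \<open>
  For a natural lift \<open>\<Gamma>\<close> with constant bending and twist the Gram matrix of \<open>\<Gamma>, \<Gamma>', \<Gamma>''\<close> is constant,
  and therefore \<open>\<Gamma>''' = t \<Gamma>' - i c \<Gamma>\<close> with \<open>t = \<tau> - 3 \<kappa>\<^sup>2\<close> and \<open>c = 1 - 2 \<kappa> \<tau> - 2 \<kappa>\<^sup>3\<close>. Closedness
  forces the characteristic polynomial \<open>l\<^sup>3 + t l - c\<close> to have three distinct real roots \<open>x < y < z\<close>
  with rational ratios, so \<open>\<Gamma>\<close> is a sum of \<open>exp (i l s) v\<^sub>l\<close> with mutually orthogonal \<open>v\<^sub>l\<close> such that
  \<open>herm v\<^sub>l v\<^sub>l = (2 \<kappa> + l) / (3 l\<^sup>2 + t)\<close>. The first-class condition gives \<open>-2 \<kappa> < x\<close>, which makes \<open>v\<^sub>y\<close>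
  the timelike eigenvector, as it is for a symmetrical configuration of the first kind. The ratio
  of two of these weights determines \<open>\<rho>\<close>, \<open>r\<close> is \<open>z / x\<close>, and the element of \<open>SU21\<close> exists because the
  two eigenbases have the same Gram matrix.
\<close>

section \<open>Hermitian form, frame determinant and linear differential equations\<close>

lemma herm_expand:
  "herm z w = \<i> * cnj (z$1) * w$3 + cnj (z$2) * w$2 - \<i> * cnj (z$3) * w$1"
  by (simp add: herm_def hmat_def matrix_vector_mult_def sum_3 algebra_simps)

lemma linear_smult: "linear ((*s) (c::complex) :: complex^3 \<Rightarrow> _)"
  by (rule linearI) (auto simp: vec_eq_iff algebra_simps scaleR_conv_of_real[where 'a=complex])

lemma bounded_bilinear_herm: "bounded_bilinear herm"
  unfolding bilinear_conv_bounded_bilinear[symmetric] bilinear_def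
  by (auto intro!: linearI simp: herm_expand algebra_simps scaleR_conv_of_real[where 'a=complex])

lemma has_vector_derivative_smult:
  assumes "(f has_vector_derivative f') F"
  shows "((\<lambda>s. (c::complex) *s (f s :: complex^3)) has_vector_derivative c *s f') F"
  using bounded_linear.has_vector_derivative[OF _ assms, of "(*s) c"] linear_smult
  by (simp add: linear_conv_bounded_linear)

lemma has_vector_derivative_herm:
  assumes "(f has_vector_derivative f') (at s within X)" "(g has_vector_derivative g') (at s within X)"
  shows "((\<lambda>s. herm (f s) (g s)) has_vector_derivative herm (f s) g' + herm f' (g s)) (at s within X)"
  by (rule bounded_bilinear.has_vector_derivative[OF bounded_bilinear_herm assms])

lemma has_vector_derivative_nth:
  assumes "(f has_vector_derivative f') F"
  shows "((\<lambda>s. f s $ i) has_vector_derivative f' $ i) F"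
  by (rule bounded_linear.has_vector_derivative[OF bounded_linear_vec_nth assms])

definition det3 :: "complex^3 \<Rightarrow> complex^3 \<Rightarrow> complex^3 \<Rightarrow> complex" where
  "det3 a b c = det (transpose (vector [a, b, c]))"

lemma det3_expand:
  "det3 a b c = a$1 * (b$2 * c$3 - b$3 * c$2) - a$2 * (b$1 * c$3 - b$3 * c$1)
     + a$3 * (b$1 * c$2 - b$2 * c$1)"
  by (simp add: det3_def det_3 transpose_def algebra_simps)

text \<open>Cramer's rule without division. It expands a vector in the frame
  \<open>\<Gamma>\<close>, \<open>\<Gamma>1\<close>, \<open>\<Gamma>2\<close>, whose determinant is
  known.\<close>

lemma det3_cramer:
  "det3 a b c *s x = det3 x b c *s a + det3 a x c *s b + det3 a b x *s c"
  by (simp add: vec_eq_iff forall_3 det3_expand algebra_simps)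

lemma has_vector_derivative_det3:
  assumes "(a has_vector_derivative a') (at s)" "(b has_vector_derivative b') (at s)"
    "(c has_vector_derivative c') (at s)"
  shows "((\<lambda>s. det3 (a s) (b s) (c s)) has_vector_derivative
     det3 a' (b s) (c s) + det3 (a s) b' (c s) + det3 (a s) (b s) c') (at s)"
  unfolding det3_expand
  by (rule derivative_eq_intros assms has_vector_derivative_nth refl)+
     (simp add: algebra_simps)

text \<open>The Gram matrix is \<open>M\<^sup>* h M\<close> with columns \<open>a\<close>,
  \<open>b\<close>, \<open>c\<close> in \<open>M\<close>, and \<open>det h = - 1\<close>.\<close>

lemma det3_gram:
  "- (det3 a b c * cnj (det3 a b c)) =
    herm a a * (herm b b * herm c c - herm b c * herm c b)
  - herm a b * (herm b a * herm c c - herm b c * herm c a)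
  + herm a c * (herm b a * herm c b - herm b b * herm c a)"
  unfolding det3_expand herm_expand by (simp add: algebra_simps)

lemma has_vector_derivative_zero_imp_eq:
  assumes "\<And>s. (f has_vector_derivative 0) (at s)"
  shows "f s = f (0::real)"
proof -
  have "\<And>x. x \<in> UNIV \<Longrightarrow> (f has_derivative (\<lambda>h. 0)) (at x within UNIV)"
    using assms by (simp add: has_vector_derivative_def)
  from has_derivative_zero_unique[OF convex_UNIV this] show ?thesis by auto
qed

text \<open>Integrating factor \<open>exp (- a s)\<close>. The forcing term is resonant:
  \<open>b = 0\<close> serves eigenvectors, general \<open>b\<close> the generalized eigenvector of
  a double root.\<close>

lemma linear_ode_exp:
  fixes f :: "real \<Rightarrow> complex"
  assumes "\<And>s. (f has_vector_derivative a * f s + b * exp (a * of_real s)) (at s)"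
  shows "f s = exp (a * of_real s) * (f 0 + b * of_real s)"
proof -
  define g where "g s = exp (- a * of_real s) * f s - b * of_real s" for s
  have "(g has_vector_derivative 0) (at s)" for s
  proof -
    have e: "((\<lambda>s. exp (- a * of_real s)) has_vector_derivative - a * exp (- a * of_real s)) (at s)"
      by (auto intro!: derivative_eq_intros has_vector_derivative_real_field)
    have l: "((\<lambda>s. b * complex_of_real s) has_vector_derivative b) (at s)"
      by (auto intro!: derivative_eq_intros has_vector_derivative_real_field)
    have "exp (- a * of_real s) * exp (a * of_real s) = 1"
      by (simp add: exp_minus)
    then show ?thesis
      unfolding g_def
      by (intro has_vector_derivative_eq_rhs[OF has_vector_derivative_diff[OF
            has_vector_derivative_mult[OF e assms] l]]) (simp add: algebra_simps)
  qed
  then have "g s = g 0"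
    by (rule has_vector_derivative_zero_imp_eq)
  then have "exp (- a * of_real s) * f s = f 0 + b * of_real s"
    by (simp add: g_def algebra_simps)
  then have "exp (a * of_real s) * (exp (- a * of_real s) * f s)
      = exp (a * of_real s) * (f 0 + b * of_real s)"
    by simp
  then show ?thesis
    by (simp add: mult.assoc[symmetric] exp_minus)
qed

lemma herm_add_left: "herm (x + y) z = herm x z + herm y z"
  and herm_add_right: "herm z (x + y) = herm z x + herm z y"
  and herm_diff_left: "herm (x - y) z = herm x z - herm y z"
  and herm_diff_right: "herm z (x - y) = herm z x - herm z y"
  and herm_smult_left: "herm (c *s x) z = cnj c * herm x z"
  and herm_smult_right: "herm z (c *s x) = c * herm z x"
  by (simp_all add: herm_expand algebra_simps)

lemmas herm_simps = herm_add_left herm_add_right herm_diff_left herm_diff_right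
  herm_smult_left herm_smult_right

lemma cnj_herm: "cnj (herm x y) = herm y x"
  by (simp add: herm_expand)

lemma const_herm_deriv:
  assumes "\<And>s. herm (f s) (g s) = k" "(f has_vector_derivative f') (at s)"
    "(g has_vector_derivative g') (at s)"
  shows "herm (f s) g' + herm f' (g s) = 0"
proof -
  have "((\<lambda>s. k) has_vector_derivative herm (f s) g' + herm f' (g s)) (at s)"
    using has_vector_derivative_herm[OF assms(2,3)] assms(1) by simp
  from vector_derivative_unique_at[OF this has_vector_derivative_const] show ?thesis .
qed

lemma bounded_bilinear_smult: "bounded_bilinear ((*s) :: complex \<Rightarrow> complex^3 \<Rightarrow> _)"
  unfolding bilinear_conv_bounded_bilinear[symmetric] bilinear_def
  by (auto intro!: linearI simp: vec_eq_iff algebra_simps scaleR_conv_of_real[where 'a=complex])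

lemma has_vector_derivative_shift:
  assumes "\<And>s. (f has_vector_derivative f' s) (at s)"
  shows "((\<lambda>s. f (s + w)) has_vector_derivative f' (s + w :: real)) (at s)"
proof -
  have "((\<lambda>s. s + w) has_vector_derivative 1) (at s)"
    by (auto intro!: derivative_eq_intros)
  from vector_diff_chain_at[OF this assms] show ?thesis
    by (simp add: o_def)
qed

lemma derivative_quasiperiodic:
  assumes "\<And>s. (f has_vector_derivative f' s) (at s)" "\<And>s. f (s + w :: real) = k *s f s"
  shows "f' (s + w) = k *s (f' s :: complex^3)"
proof (rule vector_derivative_unique_at)
  show "((\<lambda>s. f (s + w)) has_vector_derivative f' (s + w)) (at s)"
    by (rule has_vector_derivative_shift[OF assms(1)])
  show "((\<lambda>s. f (s + w)) has_vector_derivative k *s f' s) (at s)"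
    unfolding assms(2) by (rule has_vector_derivative_smult[OF assms(1)])
qed

lemma proj_eqD:
  assumes "proj z = proj w"
  obtains k where "z = k *s w"
proof -
  have "z \<in> vec.span {w}"
    using assms vec.span_base[of z "{z}"] by (auto simp: proj_def)
  then show ?thesis
    using that by (auto simp: vec.span_singleton)
qed

lemma smult_right_cancel: "(a *s (v::complex^3) = b *s v) \<longleftrightarrow> a = b \<or> v = 0"
  by (auto simp: vec_eq_iff)

section \<open>The linear system of a natural isoparametric lift\<close>

locale natural_isoparametric =
  fixes \<Gamma> :: "real \<Rightarrow> complex^3" and \<kappa> \<tau> :: real
  assumes smooth: "smooth \<Gamma>"
    and null: "herm (\<Gamma> s) (\<Gamma> s) = 0"
    and natural: "herm (\<Gamma> s) (dds \<Gamma> s) = \<i>"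
    and wilczynski: "det3 (\<Gamma> s) (dds \<Gamma> s) (dds (dds \<Gamma>) s) = - 1"
    and bending: "bending \<Gamma> s = \<kappa>"
    and twist: "twist \<Gamma> s = \<tau>"
begin

definition "t = \<tau> - 3 * \<kappa>^2"
definition "c = 1 - 2 * \<kappa> * \<tau> - 2 * \<kappa>^3"

abbreviation "\<Gamma>1 \<equiv> dds \<Gamma>"
abbreviation "\<Gamma>2 \<equiv> dds \<Gamma>1"
abbreviation "\<Gamma>3 \<equiv> dds \<Gamma>2"

lemma derivs:
  "(\<Gamma> has_vector_derivative \<Gamma>1 s) (at s)"
  "(\<Gamma>1 has_vector_derivative \<Gamma>2 s) (at s)"
  "(\<Gamma>2 has_vector_derivative \<Gamma>3 s) (at s)"
proof -
  have *: "((dds ^^ n) \<Gamma> has_vector_derivative (dds ^^ Suc n) \<Gamma> s) (at s)" for n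
    using smooth by (simp add: smooth_def dds_def vector_derivative_works[symmetric])
  show "(\<Gamma> has_vector_derivative \<Gamma>1 s) (at s)" "(\<Gamma>1 has_vector_derivative \<Gamma>2 s) (at s)"
    "(\<Gamma>2 has_vector_derivative \<Gamma>3 s) (at s)"
    using *[of 0] *[of 1] *[of 2] by (simp_all add: numeral_2_eq_2)
qed

lemma gram01: "herm (\<Gamma> s) (\<Gamma>1 s) = \<i>" "herm (\<Gamma>1 s) (\<Gamma> s) = - \<i>"
  using natural cnj_herm[of "\<Gamma> s" "\<Gamma>1 s"] by auto

lemma gram11: "herm (\<Gamma>1 s) (\<Gamma>1 s) = 2 * \<kappa>"
proof -
  have "Re (herm (\<Gamma>1 s) (\<Gamma>1 s)) = 2 * \<kappa>"
    using bending[of s] by (simp add: bending_def)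
  moreover have "Im (herm (\<Gamma>1 s) (\<Gamma>1 s)) = 0"
    using cnj_herm[of "\<Gamma>1 s" "\<Gamma>1 s"] by (metis Reals_cnj_iff complex_is_Real_iff)
  ultimately show ?thesis
    by (simp add: complex_eq_iff)
qed

lemma gram02: "herm (\<Gamma> s) (\<Gamma>2 s) = - 2 * \<kappa>" "herm (\<Gamma>2 s) (\<Gamma> s) = - 2 * \<kappa>"
proof -
  show *: "herm (\<Gamma> s) (\<Gamma>2 s) = - 2 * \<kappa>"
    using const_herm_deriv[OF natural derivs(1,2)[of s]] gram11[of s] by (simp add: eq_neg_iff_add_eq_0)
  then show "herm (\<Gamma>2 s) (\<Gamma> s) = - 2 * \<kappa>"
    using cnj_herm[of "\<Gamma> s" "\<Gamma>2 s"] by simp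
qed

text \<open>The twist fixes the imaginary part; constancy of the bending kills the real
  part.\<close>

lemma gram12: "herm (\<Gamma>1 s) (\<Gamma>2 s) = - \<i> * t" "herm (\<Gamma>2 s) (\<Gamma>1 s) = \<i> * t"
proof -
  have i: "Im (herm (\<Gamma>2 s) (\<Gamma>1 s)) = t"
    using twist[of s] bending[of s] by (simp add: twist_def t_def)
  have "herm (\<Gamma>1 s) (\<Gamma>2 s) + herm (\<Gamma>2 s) (\<Gamma>1 s) = 0"
    by (rule const_herm_deriv[OF gram11 derivs(2,2)])
  then have "Re (herm (\<Gamma>2 s) (\<Gamma>1 s)) = 0"
    using cnj_herm[of "\<Gamma>2 s" "\<Gamma>1 s"] by (auto simp: complex_eq_iff)
  with i show *: "herm (\<Gamma>2 s) (\<Gamma>1 s) = \<i> * t"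
    by (simp add: complex_eq_iff)
  then show "herm (\<Gamma>1 s) (\<Gamma>2 s) = - \<i> * t"
    using cnj_herm[of "\<Gamma>2 s" "\<Gamma>1 s"] by simp
qed

text \<open>The only entry that needs the determinant: \<open>det3_gram\<close> with determinant -1
  is a linear equation for it.\<close>

lemma gram22: "herm (\<Gamma>2 s) (\<Gamma>2 s) = c - 2 * \<kappa> * t"
proof -
  have "c - 2 * \<kappa> * t = 1 - 4 * \<kappa> * t - 8 * \<kappa>^3"
    by (simp add: c_def t_def power2_eq_square power3_eq_cube algebra_simps)
  then have "complex_of_real (c - 2 * \<kappa> * t) = of_real (1 - 4 * \<kappa> * t - 8 * \<kappa>^3)"
    by (rule arg_cong)
  moreover have "herm (\<Gamma>2 s) (\<Gamma>2 s) = 1 - 4 * \<kappa> * t - 8 * \<kappa>^3"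
    using det3_gram[of "\<Gamma> s" "\<Gamma>1 s" "\<Gamma>2 s"] unfolding wilczynski null gram01 gram11 gram02 gram12
    by (simp add: power3_eq_cube algebra_simps)
  ultimately show ?thesis
    by simp
qed

lemma gram03: "herm (\<Gamma> s) (\<Gamma>3 s) = \<i> * t"
  using const_herm_deriv[OF gram02(1) derivs(1,3)[of s]] gram12 by simp

lemma gram13: "herm (\<Gamma>1 s) (\<Gamma>3 s) = 2 * \<kappa> * t - c"
  using const_herm_deriv[OF gram12(1) derivs(2,3)[of s]] unfolding gram22
  by (simp add: algebra_simps add_eq_0_iff)

text \<open>Differentiating the constant frame determinant puts \<open>\<Gamma>3\<close> in the span
  of \<open>\<Gamma>\<close> and \<open>\<Gamma>1\<close>. Pairing with these two vectors then fixes
  both coefficients.\<close>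

lemma third_derivative: "\<Gamma>3 s = complex_of_real t *s \<Gamma>1 s - (\<i> * c) *s \<Gamma> s"
proof -
  let ?R = "\<Gamma>3 s - (complex_of_real t *s \<Gamma>1 s - (\<i> * c) *s \<Gamma> s)"
  have "((\<lambda>s. - 1) has_vector_derivative
      det3 (\<Gamma>1 s) (\<Gamma>1 s) (\<Gamma>2 s) + det3 (\<Gamma> s) (\<Gamma>2 s) (\<Gamma>2 s) + det3 (\<Gamma> s) (\<Gamma>1 s) (\<Gamma>3 s)) (at s)"
    using has_vector_derivative_det3[OF derivs[of s]] unfolding wilczynski .
  from vector_derivative_unique_at[OF this has_vector_derivative_const]
  have "det3 (\<Gamma> s) (\<Gamma>1 s) (\<Gamma>3 s) = 0"
    by (simp add: det3_expand algebra_simps)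
  then have d: "det3 (\<Gamma> s) (\<Gamma>1 s) ?R = 0"
    by (simp add: det3_expand algebra_simps)
  define \<alpha> \<beta> where "\<alpha> = det3 ?R (\<Gamma>1 s) (\<Gamma>2 s)" and "\<beta> = det3 (\<Gamma> s) ?R (\<Gamma>2 s)"
  have R: "- ?R = \<alpha> *s \<Gamma> s + \<beta> *s \<Gamma>1 s"
    using det3_cramer[of "\<Gamma> s" "\<Gamma>1 s" "\<Gamma>2 s" ?R] unfolding wilczynski d \<alpha>_def[symmetric] \<beta>_def[symmetric]
    by (simp only: vector_smult_lneg vector_smult_lid vector_smult_lzero add_0_right)
  have "herm (\<Gamma> s) (- ?R) = 0"
    using gram03[of s] gram01[of s] null[of s]
    by (simp only: minus_diff_eq herm_simps) simp
  then have "\<beta> = 0"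
    unfolding R herm_simps null gram01 by simp
  have "herm (\<Gamma>1 s) (- ?R) = 0"
    using gram13[of s] gram01[of s] gram11[of s]
    by (simp only: minus_diff_eq herm_simps) (simp add: algebra_simps)
  then have "\<alpha> = 0"
    unfolding R herm_simps gram01 using \<open>\<beta> = 0\<close> by simp
  show ?thesis
    using R \<open>\<alpha> = 0\<close> \<open>\<beta> = 0\<close> by (simp only: vector_smult_lzero add_0_right neg_equal_0_iff_equal right_minus_eq)
qed

text \<open>If \<open>l\<close>, \<open>m\<close>, \<open>n\<close> are the roots of the characteristic polynomial and \<open>D\<close> is differentiation, then
  \<open>V l\<close> is \<open>(D - i m) (D - i n) \<Gamma>\<close>.\<close>

definition V :: "complex \<Rightarrow> real \<Rightarrow> complex^3" where
  "V l s = \<Gamma>2 s + (\<i> * l) *s \<Gamma>1 s - (l^2 + t) *s \<Gamma> s"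

text \<open>Applying \<open>D - i l\<close> to \<open>V l\<close> completes the characteristic
  operator, which annihilates \<open>\<Gamma>\<close>.\<close>

lemma V_deriv:
  assumes "l^3 + complex_of_real t * l = c"
  shows "(V l has_vector_derivative (\<i> * l) *s V l s) (at s)"
proof -
  have "(V l has_vector_derivative \<Gamma>3 s + (\<i> * l) *s \<Gamma>2 s - (l^2 + t) *s \<Gamma>1 s) (at s)"
    unfolding V_def
    by (intro has_vector_derivative_add has_vector_derivative_diff has_vector_derivative_smult derivs)
  moreover have "\<Gamma>3 s + (\<i> * l) *s \<Gamma>2 s - (l^2 + t) *s \<Gamma>1 s = (\<i> * l) *s V l s"
  proof (subst vec_eq_iff, intro allI)
    fix j
    show "(\<Gamma>3 s + (\<i> * l) *s \<Gamma>2 s - (l^2 + t) *s \<Gamma>1 s) $ j = ((\<i> * l) *s V l s) $ j"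
      unfolding third_derivative assms[symmetric] V_def vector_add_component
        vector_minus_component vector_smult_component
      using i_squared by algebra
  qed
  ultimately show ?thesis
    by simp
qed

lemma V_exp:
  assumes "l^3 + complex_of_real t * l = c"
  shows "V l s = exp (\<i> * l * s) *s V l 0"
proof -
  have "V l s $ j = exp (\<i> * l * s) * (V l 0 $ j + 0 * of_real s)" for j
    by (rule linear_ode_exp) (use has_vector_derivative_nth[OF V_deriv[OF assms]] in simp)
  then show ?thesis
    by (simp add: vec_eq_iff)
qed

lemma herm_\<Gamma>_V: "herm (\<Gamma> s) (V l s) = - (2 * of_real \<kappa> + l)"
  by (simp add: V_def herm_simps null gram01 gram02 mult.commute[of _ \<i>])

text \<open>Hence \<open>- 2 \<kappa>\<close> is never an eigenvalue, so \<open>V l\<close> does not vanish.\<close>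

lemma char_neg_two_kappa: "(- 2 * \<kappa>)^3 + t * (- 2 * \<kappa>) - c = - 1"
  by (simp add: t_def c_def power2_eq_square power3_eq_cube algebra_simps)

lemma V_nonzero:
  assumes "l^3 + complex_of_real t * l = c"
  shows "V l s \<noteq> 0"
proof
  assume "V l s = 0"
  then have "l = of_real (- 2 * \<kappa>)"
    using herm_\<Gamma>_V[of s l] by (simp add: herm_expand add_eq_0_iff2)
  then have "of_real ((- 2 * \<kappa>)^3 + t * (- 2 * \<kappa>) - c) = (0::complex)"
    using assms by simp
  then show False
    unfolding char_neg_two_kappa by simp
qed

lemma herm_V:
  "herm (V l s) (V m s) = c - 2 * \<kappa> * t + 2 * \<kappa> * (cnj l^2 + m^2 + cnj l * m + 2 * t) + cnj l * m * (cnj l + m)"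
  unfolding V_def herm_simps null gram01 gram02 gram11 gram12 gram22 complex_cnj_add complex_cnj_diff
    complex_cnj_mult complex_cnj_i complex_cnj_power complex_cnj_complex_of_real of_real_add of_real_mult of_real_diff
    of_real_minus of_real_numeral
  using i_squared by algebra

end

section \<open>Closed curves and their spectrum\<close>

context natural_isoparametric
begin

text \<open>Projective periodicity only gives a factor \<open>C s\<close>. The natural normalization
  makes it unimodular, and constant bending then makes it constant.\<close>

lemma monodromy:
  assumes "\<And>s. proj (\<Gamma> (s + w)) = proj (\<Gamma> s)"
  obtains k where "norm k = 1" "\<And>s. \<Gamma> (s + w) = k *s \<Gamma> s"
proof -
  \<comment> \<open>Pairing with \<open>\<Gamma>1\<close> isolates the factor, since
    \<open>herm (\<Gamma>1 s) (\<Gamma> s) = - \<i>\<close>; this formula also shows that the factor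
    is differentiable.\<close>
  define C where "C s = \<i> * herm (\<Gamma>1 s) (\<Gamma> (s + w))" for s
  define C' where "C' s = \<i> * (herm (\<Gamma>1 s) (\<Gamma>1 (s + w)) + herm (\<Gamma>2 s) (\<Gamma> (s + w)))" for s
  have shift: "\<Gamma> (s + w) = C s *s \<Gamma> s" for s
  proof -
    obtain k where "\<Gamma> (s + w) = k *s \<Gamma> s"
      using proj_eqD[OF assms] .
    then show ?thesis
      by (simp add: C_def herm_simps gram01 mult.commute[of _ \<i>])
  qed
  have dC: "(C has_vector_derivative C' s) (at s)" for s
    unfolding C_def C'_def
    by (intro has_vector_derivative_mult_right has_vector_derivative_herm derivs
        has_vector_derivative_shift[OF derivs(1)])
  have shift1: "\<Gamma>1 (s + w) = C s *s \<Gamma>1 s + C' s *s \<Gamma> s" for s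
  proof (rule vector_derivative_unique_at)
    show "((\<lambda>s. \<Gamma> (s + w)) has_vector_derivative \<Gamma>1 (s + w)) (at s)"
      by (rule has_vector_derivative_shift[OF derivs(1)])
    show "((\<lambda>s. \<Gamma> (s + w)) has_vector_derivative C s *s \<Gamma>1 s + C' s *s \<Gamma> s) (at s)"
      unfolding shift
      by (rule bounded_bilinear.has_vector_derivative[OF bounded_bilinear_smult dC derivs(1)])
  qed
  have unit: "cnj (C s) * C s = 1" for s
    using natural[of "s + w"] unfolding shift shift1 herm_simps null gram01
    by (simp add: mult.commute)
  have "C' s = 0" for s
  proof -
    have "((\<lambda>s. cnj (C s) * C s) has_vector_derivative cnj (C s) * C' s + cnj (C' s) * C s) (at s)"
      by (intro has_vector_derivative_mult dC
          bounded_linear.has_vector_derivative[OF bounded_linear_cnj dC])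
    then have "((\<lambda>s. 1) has_vector_derivative cnj (C s) * C' s + cnj (C' s) * C s) (at s)"
      unfolding unit .
    from vector_derivative_unique_at[OF this has_vector_derivative_const]
    have 1: "cnj (C s) * C' s + cnj (C' s) * C s = 0" .
    \<comment> \<open>By the previous equation \<open>cnj (C s) * C' s\<close> is purely imaginary.
      Comparing the bending at \<open>s + w\<close> and \<open>s\<close> makes it real as
      well.\<close>
    have "2 * \<kappa> = cnj (C s) * C s * (2 * \<kappa>) + \<i> * (cnj (C' s) * C s - cnj (C s) * C' s)"
      using gram11[of "s + w"] unfolding shift1 herm_simps null gram01 gram11
      by (simp add: algebra_simps)
    then have "cnj (C' s) * C s - cnj (C s) * C' s = 0"
      unfolding unit by simp
    with 1 have "cnj (C s) * C' s = 0"
      by algebra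
    with unit[of s] show ?thesis
      by auto
  qed
  then have "C s = C 0" for s
    using dC by (intro has_vector_derivative_zero_imp_eq) simp
  moreover have "norm (C 0) = 1"
    using unit[of 0] by (metis complex_norm_square mult.commute norm_ge_zero
        of_real_1 of_real_eq_iff of_real_power power2_eq_1_iff real_sqrt_abs real_sqrt_one abs_of_nonneg)
  ultimately show thesis
    using that shift by metis
qed

end

locale closed_natural_isoparametric = natural_isoparametric +
  fixes w :: real and k :: complex
  assumes period_pos: "w > 0" and norm_monodromy: "norm k = 1" and monodromy_eq: "\<Gamma> (s + w) = k *s \<Gamma> s"
begin

lemma shift1: "\<Gamma>1 (s + w) = k *s \<Gamma>1 s"
  by (rule derivative_quasiperiodic[OF derivs(1) monodromy_eq])

lemma shift2: "\<Gamma>2 (s + w) = k *s \<Gamma>2 s"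
  by (rule derivative_quasiperiodic[OF derivs(2) shift1])

text \<open>Over one period \<open>V l\<close> is multiplied by \<open>k\<close>, as
  \<open>\<Gamma>\<close> and its derivatives are, and also by \<open>exp (\<i> * l * w)\<close>; it
  does not vanish.\<close>

lemma root_exp:
  assumes "l^3 + complex_of_real t * l = c"
  shows "exp (\<i> * l * w) = k"
proof -
  have "V l (0 + w) = k *s V l 0"
    unfolding V_def shift1 shift2 monodromy_eq
    by (simp add: vec_eq_iff algebra_simps)
  then show ?thesis
    using V_exp[OF assms, of w] V_nonzero[OF assms, of 0] by (simp add: smult_right_cancel)
qed

lemma root_real:
  assumes "l^3 + complex_of_real t * l = c"
  obtains x where "l = complex_of_real x"
proof -
  have "norm (exp (\<i> * l * w)) = 1"
    unfolding root_exp[OF assms] by (rule norm_monodromy)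
  then have "Im l = 0"
    using period_pos by simp
  then show thesis
    using that by (metis complex_is_Real_iff Reals_cases)
qed

lemma root_simple:
  assumes "l^3 + complex_of_real t * l = c"
  shows "3 * l^2 + t \<noteq> 0"
proof
  assume double: "3 * l^2 + t = 0"
  \<comment> \<open>\<open>- 2 l\<close> is the third root, so \<open>W\<close> is a generalized eigenvector and grows linearly.\<close>
  define W where "W s = \<Gamma>1 s + (2 * \<i> * l) *s \<Gamma> s" for s
  have dW: "(W has_vector_derivative (\<i> * l) *s W s + V l s) (at s)" for s
  proof -
    have "(W has_vector_derivative \<Gamma>2 s + (2 * \<i> * l) *s \<Gamma>1 s) (at s)"
      unfolding W_def by (intro has_vector_derivative_add has_vector_derivative_smult derivs)
    moreover have "(\<i> * l) *s W s + V l s = \<Gamma>2 s + (2 * \<i> * l) *s \<Gamma>1 s"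
    proof (subst vec_eq_iff, intro allI)
      fix j
      show "((\<i> * l) *s W s + V l s) $ j = (\<Gamma>2 s + (2 * \<i> * l) *s \<Gamma>1 s) $ j"
        unfolding W_def V_def vector_add_component vector_minus_component vector_smult_component
        using i_squared double by algebra
    qed
    ultimately show ?thesis
      by simp
  qed
  have "W w $ j = exp (\<i> * l * w) * (W 0 $ j + V l 0 $ j * w)" for j
  proof (rule linear_ode_exp)
    fix s
    have "(\<i> * l) * W s $ j + V l 0 $ j * exp (\<i> * l * s) = ((\<i> * l) *s W s + V l s) $ j"
      unfolding V_exp[OF assms, of s] by simp
    then show "((\<lambda>s. W s $ j) has_vector_derivative
        (\<i> * l) * W s $ j + V l 0 $ j * exp (\<i> * l * s)) (at s)"
      using has_vector_derivative_nth[OF dW, of j] by simp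
  qed
  moreover have "W (0 + w) = k *s W 0"
    unfolding W_def shift1 monodromy_eq by (simp add: vec_eq_iff algebra_simps)
  \<comment> \<open>The two values of \<open>W w\<close> differ exactly by the term that grows
    linearly, so this term must vanish.\<close>
  ultimately have "k * (V l 0 $ j * w) = 0" for j
    unfolding root_exp[OF assms] by (auto simp: vec_eq_iff distrib_left)
  moreover have "k \<noteq> 0"
    using norm_monodromy by auto
  ultimately have "V l 0 = 0"
    using period_pos by (simp add: vec_eq_iff)
  with V_nonzero[OF assms] show False
    by blast
qed

section \<open>Three distinct real eigenvalues with rational ratios\<close>

text \<open>Vieta's relations for the factorization of \<open>l^3 + t l - c\<close>. They are
  symmetric, so facts about particular entries transfer to the others by permutation.\<close>

definition eigenvalue_triple :: "real \<Rightarrow> real \<Rightarrow> real \<Rightarrow> bool" where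
  "eigenvalue_triple x y z \<longleftrightarrow> x + y + z = 0 \<and> t = x * y + x * z + y * z \<and> c = x * y * z"

lemma eigenvalue_triple_root:
  assumes "eigenvalue_triple x y z"
  shows "complex_of_real x ^ 3 + complex_of_real t * x = c"
proof -
  have "x^3 + t * x = c"
    using assms unfolding eigenvalue_triple_def by algebra
  then show ?thesis
    by (metis of_real_add of_real_mult of_real_power)
qed

text \<open>A repeated entry would also be a root of the derivative \<open>3 l^2 + t\<close>,
  against \<open>root_simple\<close>.\<close>

lemma eigenvalue_triple_distinct:
  assumes "eigenvalue_triple x y z"
  shows "x \<noteq> y"
proof
  assume "x = y"
  then have "3 * x^2 + t = 0"
  proof -
    have "z = - 2 * x"
      using assms \<open>x = y\<close> by (simp add: eigenvalue_triple_def)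
    then show ?thesis
      using assms \<open>x = y\<close> by (simp add: eigenvalue_triple_def power2_eq_square)
  qed
  then have "complex_of_real (3 * x^2 + t) = 0"
    by simp
  then show False
    using root_simple[OF eigenvalue_triple_root[OF assms]] by simp
qed

lemma eigenvalue_triple_exists: "\<exists>x y z. eigenvalue_triple x y z"
proof -
  have "\<not> constant (poly [:- of_real c, of_real t, 0, 1 :: complex:])"
    by (simp add: Fundamental_Theorem_Algebra.constant_degree)
  then obtain l where "poly [:- of_real c, of_real t, 0, 1 :: complex:] l = 0"
    using fundamental_theorem_of_algebra by blast
  then have l: "l^3 + complex_of_real t * l = c"
    by (simp add: power3_eq_cube algebra_simps)
  obtain x where x: "l = complex_of_real x"
    using root_real[OF l] .
  \<comment> \<open>A root of the quadratic cofactor \<open>m^2 + l m + l^2 + t\<close>. The square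
    root is complex; \<open>root_real\<close> shows afterwards that \<open>m\<close> is
    real.\<close>
  define m where "m = (- l + csqrt (- 3 * l^2 - 4 * complex_of_real t)) / 2"
  have "(2 * m + l)^2 = - 3 * l^2 - 4 * complex_of_real t"
  proof -
    have "2 * m + l = csqrt (- 3 * l^2 - 4 * complex_of_real t)"
      by (simp add: m_def field_simps)
    then show ?thesis
      by simp
  qed
  then have "4 * (l^2 + l * m + m^2 + t) = 0"
    by algebra
  then have lm: "l^2 + l * m + m^2 + t = 0"
    by (metis mult_eq_0_iff zero_neq_numeral)
  then have m: "m^3 + complex_of_real t * m = c"
    using l by algebra
  obtain y where y: "m = complex_of_real y"
    using root_real[OF m] .
  have "complex_of_real (x^2 + x * y + y^2 + t) = 0"
    using lm unfolding x y by simp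
  then have 1: "x^2 + x * y + y^2 + t = 0"
    unfolding of_real_eq_0_iff .
  have "complex_of_real (x^3 + t * x) = of_real c"
    using l unfolding x by simp
  then have 2: "x^3 + t * x = c"
    unfolding of_real_eq_iff .
  have "eigenvalue_triple x y (- x - y)"
    unfolding eigenvalue_triple_def
  proof (intro conjI)
    show "t = x * y + x * (- x - y) + y * (- x - y)" "c = x * y * (- x - y)"
      using 1 2 by algebra+
  qed simp
  then show ?thesis
    by blast
qed

lemma eigenvalue_triple_sorted:
  obtains x y z where "eigenvalue_triple x y z" "x < y" "y < z"
proof -
  obtain x y z where e: "eigenvalue_triple x y z"
    using eigenvalue_triple_exists by blast
  have perms: "eigenvalue_triple x z y" "eigenvalue_triple y x z" "eigenvalue_triple y z x"
    "eigenvalue_triple z x y" "eigenvalue_triple z y x"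
    using e by (simp_all add: eigenvalue_triple_def algebra_simps)
  have "x \<noteq> y" "x \<noteq> z" "y \<noteq> z"
    using eigenvalue_triple_distinct e perms by blast+
  then show thesis
    using that e perms by (metis linorder_neqE)
qed

lemma eigenvalue_ratio_rational:
  assumes "eigenvalue_triple x y z"
  shows "z / x \<in> \<rat>"
proof -
  have triples: "eigenvalue_triple y x z" "eigenvalue_triple z x y"
    using assms by (simp_all add: eigenvalue_triple_def algebra_simps)
  have *: "\<exists>n::int. x * w = y * w + 2 * pi * n" if "eigenvalue_triple x y' z'" "eigenvalue_triple y x' z''"
    for x y y' z' x' z''
  proof -
    have "exp (\<i> * x * w) = exp (\<i> * y * w)"
      using root_exp eigenvalue_triple_root that by metis
    then obtain n :: int where "\<i> * x * w = \<i> * y * w + of_int (2 * n) * pi * \<i>"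
      unfolding exp_eq by blast
    then have "Im (\<i> * x * w) = Im (\<i> * y * w + of_int (2 * n) * pi * \<i>)"
      by (rule arg_cong)
    then show ?thesis
      by (auto intro!: exI[of _ n])
  qed
  obtain m :: int where m: "x * w = y * w + 2 * pi * m"
    using *[OF assms triples(1)] by blast
  obtain n :: int where n: "x * w = z * w + 2 * pi * n"
    using *[OF assms triples(2)] by blast
  have "x + y + z = 0"
    using assms by (simp add: eigenvalue_triple_def)
  \<comment> \<open>Adding the two congruences and using that the eigenvalues sum to zero gives
    integer multiples of \<open>2 * pi\<close> for the tripled phases.\<close>
  then have x: "3 * w * x = 2 * pi * of_int (m + n)" and z: "3 * w * z = 2 * pi * of_int (m - 2 * n)"
    using m n by (simp, algebra)+
  \<comment> \<open>This also covers \<open>x = 0\<close>: each quotient is then 0 by the convention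
    for division by zero.\<close>
  have "z / x = (3 * w * z) / (3 * w * x)"
    using period_pos by simp
  also have "\<dots> = of_int (m - 2 * n) / of_int (m + n)"
    unfolding x z by simp
  finally show ?thesis
    by simp
qed

end

section \<open>Orthogonal eigenvector components and their signs\<close>

context closed_natural_isoparametric
begin

text \<open>The factor is the one of Lagrange interpolation; it makes \<open>\<Gamma>\<close> the sum of the three components.\<close>

definition v :: "real \<Rightarrow> real \<Rightarrow> real \<Rightarrow> complex^3" where
  "v x y z = complex_of_real (- 1 / ((x - y) * (x - z))) *s V x 0"

text \<open>With Vieta's relations, \<open>herm_V\<close> at \<open>l = m = x\<close> factors as
  \<open>2 * \<kappa> + x\<close> times the derivative \<open>(x - y) * (x - z)\<close> of the
  characteristic polynomial. The squared interpolation factor leaves one copy in the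
  denominator.\<close>

lemma herm_v_self:
  assumes "eigenvalue_triple x y z" "eigenvalue_triple y x z" "eigenvalue_triple x z y"
  shows "herm (v x y z) (v x y z) = complex_of_real ((2 * \<kappa> + x) / ((x - y) * (x - z)))"
proof -
  have ne: "x \<noteq> y" "x \<noteq> z"
    using assms eigenvalue_triple_distinct by blast+
  have "c - 2 * \<kappa> * t + 2 * \<kappa> * (x^2 + x^2 + x * x + 2 * t) + x * x * (x + x)
      = (2 * \<kappa> + x) * ((x - y) * (x - z))"
  proof -
    have "z = - x - y" "t = x * y + x * z + y * z" "c = x * y * z"
      using assms(1) by (auto simp: eigenvalue_triple_def)
    then show ?thesis
      by algebra
  qed
  then have "herm (V x 0) (V x 0) = complex_of_real ((2 * \<kappa> + x) * ((x - y) * (x - z)))"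
    unfolding herm_V by (simp flip: of_real_mult of_real_add of_real_diff of_real_power add: mult_ac)
  then have "herm (v x y z) (v x y z) =
      complex_of_real (- 1 / ((x - y) * (x - z)) * (- 1 / ((x - y) * (x - z)) * ((2 * \<kappa> + x) * ((x - y) * (x - z)))))"
    by (simp only: v_def herm_simps complex_cnj_complex_of_real of_real_mult)
  also have "- 1 / ((x - y) * (x - z)) * (- 1 / ((x - y) * (x - z)) * ((2 * \<kappa> + x) * ((x - y) * (x - z))))
      = (2 * \<kappa> + x) / ((x - y) * (x - z))"
    using ne by (simp add: divide_simps)
  finally show ?thesis .
qed

text \<open>The polynomial in \<open>herm_V\<close> vanishes at two different entries of a triple.
  The remaining arguments of \<open>v\<close> only affect scaling, hence they are free.\<close>

lemma herm_v_orthogonal: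
  assumes "eigenvalue_triple x y z"
  shows "herm (v x y' z') (v y x' z'') = 0"
proof -
  have "c - 2 * \<kappa> * t + 2 * \<kappa> * (x^2 + y^2 + x * y + 2 * t) + x * y * (x + y) = 0"
  proof -
    have "z = - x - y" "t = x * y + x * z + y * z" "c = x * y * z"
      using assms(1) by (auto simp: eigenvalue_triple_def)
    then show ?thesis
      by algebra
  qed
  then have "complex_of_real (c - 2 * \<kappa> * t + 2 * \<kappa> * (x^2 + y^2 + x * y + 2 * t) + x * y * (x + y)) = 0"
    by (simp only: of_real_0)
  then have "herm (V x 0) (V y 0) = 0"
    unfolding herm_V by simp
  then show ?thesis
    by (simp only: v_def herm_simps mult_zero_right)
qed

lemma decomposition:
  assumes "eigenvalue_triple x y z" "eigenvalue_triple y x z" "eigenvalue_triple z x y"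
  shows "\<Gamma> s = exp (\<i> * x * s) *s v x y z + exp (\<i> * y * s) *s v y x z + exp (\<i> * z * s) *s v z x y"
proof -
  have "x \<noteq> y" "y \<noteq> z" "x \<noteq> z"
    using assms eigenvalue_triple_distinct[of x y z] eigenvalue_triple_distinct[of z x y]
      eigenvalue_triple_distinct[of y z x] by (auto simp: eigenvalue_triple_def algebra_simps)
  have *: "exp (\<i> * x * s) *s v x y z = complex_of_real (- 1 / ((x - y) * (x - z))) *s V x s"
    if "eigenvalue_triple x y' z'" for x y z y' z'
    unfolding V_exp[OF eigenvalue_triple_root[OF that], of s] v_def
    by (simp add: vec_eq_iff)
  define X Y Z where "X = complex_of_real x" and "Y = complex_of_real y" and "Z = complex_of_real z"
  have ne: "X \<noteq> Y" "Y \<noteq> Z" "X \<noteq> Z"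
    using \<open>x \<noteq> y\<close> \<open>y \<noteq> z\<close> \<open>x \<noteq> z\<close> by (auto simp: X_def Y_def Z_def)
  have sum: "X + Y + Z = 0"
    using assms(1) by (simp add: eigenvalue_triple_def X_def Y_def Z_def flip: of_real_add)
  \<comment> \<open>The three sums are, up to sign, the second divided differences of 1,
    \<open>X\<close> and \<open>X^2\<close>, that is 0, 0 and 1.\<close>
  have coeff0: "- 1 / ((X - Y) * (X - Z)) - 1 / ((Y - X) * (Y - Z)) - 1 / ((Z - X) * (Z - Y)) = 0"
    using ne by (simp add: divide_simps) (simp add: algebra_simps power2_eq_square)
  have coeff1: "- X / ((X - Y) * (X - Z)) - Y / ((Y - X) * (Y - Z)) - Z / ((Z - X) * (Z - Y)) = 0"
    using ne by (simp add: divide_simps) (simp add: algebra_simps power2_eq_square)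
  have coeff2: "X^2 / ((X - Y) * (X - Z)) + Y^2 / ((Y - X) * (Y - Z)) + Z^2 / ((Z - X) * (Z - Y)) = 1"
    using ne by (simp add: divide_simps) (simp add: algebra_simps power2_eq_square)
  show ?thesis
    unfolding *[OF assms(1)] *[OF assms(2)] *[OF assms(3)]
  proof (subst vec_eq_iff, intro allI)
    fix j
    have "complex_of_real (- 1 / ((x - y) * (x - z))) * V x s $ j
        + complex_of_real (- 1 / ((y - x) * (y - z))) * V y s $ j
        + complex_of_real (- 1 / ((z - x) * (z - y))) * V z s $ j
      = (\<Gamma>2 s $ j - t * \<Gamma> s $ j) * (- 1 / ((X - Y) * (X - Z)) - 1 / ((Y - X) * (Y - Z)) - 1 / ((Z - X) * (Z - Y)))
      + \<i> * \<Gamma>1 s $ j * (- X / ((X - Y) * (X - Z)) - Y / ((Y - X) * (Y - Z)) - Z / ((Z - X) * (Z - Y)))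
      + \<Gamma> s $ j * (X^2 / ((X - Y) * (X - Z)) + Y^2 / ((Y - X) * (Y - Z)) + Z^2 / ((Z - X) * (Z - Y)))"
      unfolding V_def X_def[symmetric] Y_def[symmetric] Z_def[symmetric] of_real_divide of_real_mult
        of_real_diff of_real_minus of_real_1 vector_add_component vector_minus_component vector_smult_component
      by (simp add: divide_inverse algebra_simps)
    also have "\<dots> = \<Gamma> s $ j"
      unfolding coeff0 coeff1 coeff2 by simp
    finally show "\<Gamma> s $ j = (complex_of_real (- 1 / ((x - y) * (x - z))) *s V x s
        + complex_of_real (- 1 / ((y - x) * (y - z))) *s V y s
        + complex_of_real (- 1 / ((z - x) * (z - y))) *s V z s) $ j"
      by simp
  qed
qed

text \<open>The product is minus the characteristic polynomial at \<open>- 2 * \<kappa>\<close>. If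
  \<open>2 * \<kappa> + x\<close> were negative, positivity of the product would make
  \<open>2 * \<kappa> + y\<close> negative too; then \<open>- t = x^2 + x y + y^2\<close> would be
  at least \<open>12 * \<kappa>^2\<close>.\<close>

lemma first_class_eigenvalue_bound:
  assumes "eigenvalue_triple x y z" "x < y" "y < z" "sqrt \<bar>\<tau>\<bar> < 3 * \<kappa>"
  shows "2 * \<kappa> + x > 0" "(2 * \<kappa> + x) * (2 * \<kappa> + y) * (2 * \<kappa> + z) = 1"
proof -
  have z: "z = - x - y" and t: "t = x * y + x * z + y * z" and c: "c = x * y * z"
    using assms(1) by (auto simp: eigenvalue_triple_def)
  show prod: "(2 * \<kappa> + x) * (2 * \<kappa> + y) * (2 * \<kappa> + z) = 1"
    using char_neg_two_kappa z t c by algebra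
  have "0 \<le> sqrt \<bar>\<tau>\<bar>"
    by simp
  with assms(4) have "\<kappa> > 0"
    by linarith
  have "\<bar>\<tau>\<bar> < (3 * \<kappa>)^2"
    using assms(4) by (metis real_sqrt_less_iff real_sqrt_abs abs_le_D1 abs_ge_self order.strict_trans2)
  \<comment> \<open>Here the first-class condition enters:
    \<open>- t = 3 * \<kappa>^2 - \<tau>\<close> and
    \<open>- \<tau> < 9 * \<kappa>^2\<close>.\<close>
  then have t_bound: "- t < 12 * \<kappa>^2"
    by (simp add: t_def power_mult_distrib)
  show "2 * \<kappa> + x > 0"
  proof (rule ccontr)
    assume "\<not> 2 * \<kappa> + x > 0"
    with prod have x: "2 * \<kappa> + x < 0"
      by (cases "2 * \<kappa> + x = 0") auto
    have y: "2 * \<kappa> + y < 0"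
    proof (rule ccontr)
      assume "\<not> 2 * \<kappa> + y < 0"
      then have "(2 * \<kappa> + x) * ((2 * \<kappa> + y) * (2 * \<kappa> + z)) \<le> 0"
        using x assms(3) by (intro mult_nonpos_nonneg mult_nonneg_nonneg) auto
      with prod show False
        by (simp add: mult.assoc)
    qed
    have "(2 * \<kappa>) * (2 * \<kappa>) \<le> (- x) * (- x)" "(2 * \<kappa>) * (2 * \<kappa>) \<le> (- x) * (- y)"
      "(2 * \<kappa>) * (2 * \<kappa>) \<le> (- y) * (- y)"
      by (rule mult_mono; use x y \<open>\<kappa> > 0\<close> in linarith)+
    moreover have "- t = (- x) * (- x) + (- x) * (- y) + (- y) * (- y)"
      unfolding t z by algebra
    ultimately show False
      using t_bound by (simp add: power2_eq_square)
  qed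
qed

end

section \<open>Bases with equal Gram matrices\<close>

lemma conj_transpose_mult: "conj_transpose (A ** B) = conj_transpose B ** conj_transpose A"
  by (simp add: conj_transpose_def matrix_matrix_mult_def vec_eq_iff mult.commute)

lemma det_conj_transpose: "det (conj_transpose A) = cnj (det A)"
  by (simp add: conj_transpose_def det_3 algebra_simps)

lemma det_hmat: "det hmat = - 1"
  by (simp add: hmat_def det_3)

lemma conj_transpose_columns:
  "conj_transpose (\<chi> i j. a j $ i) ** hmat ** (\<chi> i j. b j $ i) = (\<chi> i j. herm (a i) (b j))"
  by (simp add: vec_eq_iff forall_3 matrix_matrix_mult_def conj_transpose_def herm_expand hmat_def sum_3)

lemma complex_cube_root_exists:
  assumes "w \<noteq> 0"
  obtains z :: complex where "z^3 = w"
proof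
  show "exp (Ln w / 3)^3 = w"
    using assms by (simp flip: exp_of_nat_mult)
qed

text \<open>The change of basis preserves the form because the Gram matrices agree, so its
  determinant is unimodular. Rescaling by a cube root \<open>\<theta>\<close> of the inverse
  determinant makes it 1; \<open>\<theta>\<close> is invisible projectively.\<close>

lemma SU21_of_gram_eq:
  fixes a b :: "3 \<Rightarrow> complex^3"
  assumes gram: "\<And>i j. herm (a i) (a j) = herm (b i) (b j)"
    and nondegenerate: "det (\<chi> i j. herm (a i) (a j)) \<noteq> 0"
  obtains A \<theta> where "A \<in> SU21" "\<theta> \<noteq> 0" "\<And>i. A *v a i = \<theta> *s b i"
proof -
  define Ma Mb :: "complex^3^3" where "Ma = (\<chi> i j. a j $ i)" and "Mb = (\<chi> i j. b j $ i)"
  have gram_eq: "conj_transpose Ma ** hmat ** Ma = conj_transpose Mb ** hmat ** Mb"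
    unfolding Ma_def Mb_def conj_transpose_columns gram ..
  have "det (conj_transpose Ma ** hmat ** Ma) \<noteq> 0"
    using nondegenerate unfolding Ma_def conj_transpose_columns .
  then have "det Ma \<noteq> 0"
    by (simp add: det_mul)
  then obtain N where N: "Ma ** N = mat 1" "N ** Ma = mat 1"
    by (metis invertible_det_nz invertible_def)
  define A0 where "A0 = Mb ** N"
  have A0: "conj_transpose A0 ** hmat ** A0 = hmat"
  proof -
    have "conj_transpose A0 ** hmat ** A0
        = conj_transpose N ** (conj_transpose Mb ** hmat ** Mb) ** N"
      by (simp add: A0_def conj_transpose_mult matrix_mul_assoc)
    also have "\<dots> = conj_transpose (Ma ** N) ** hmat ** (Ma ** N)"
      by (simp add: gram_eq[symmetric] conj_transpose_mult matrix_mul_assoc)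
    also have "\<dots> = hmat"
    proof -
      have "conj_transpose (mat 1) = mat 1"
        by (simp add: conj_transpose_def mat_def vec_eq_iff)
      then show ?thesis
        by (simp add: N)
    qed
    finally show ?thesis .
  qed
  have "det (conj_transpose A0 ** hmat ** A0) = - 1"
    unfolding A0 by (rule det_hmat)
  then have unit: "cnj (det A0) * det A0 = 1"
    by (simp add: det_mul det_conj_transpose det_hmat)
  then have "det A0 \<noteq> 0"
    by auto
  then obtain \<theta> where \<theta>: "\<theta>^3 = inverse (det A0)"
    using complex_cube_root_exists[of "inverse (det A0)"] by auto
  have "norm (det A0) = 1"
    using arg_cong[OF unit, of norm] by (simp add: norm_mult power2_eq_1_iff flip: power2_eq_square)
      (metis abs_norm_cancel abs_1 abs_minus_cancel norm_ge_zero)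
  then have "norm \<theta> ^ 3 = 1"
    by (simp add: norm_inverse \<theta> flip: norm_power)
  then have "norm \<theta> = 1"
    using power_eq_1_iff[of "norm \<theta>" 3] by simp
  then have unit_\<theta>: "cnj \<theta> * \<theta> = 1"
    by (metis complex_norm_square mult.commute of_real_1 one_power2)
  define A :: "complex^3^3" where "A = (\<chi> i j. \<theta> * A0 $ i $ j)"
  have "A \<in> SU21"
  proof -
    have "det A = \<theta>^3 * det A0"
      by (simp add: A_def det_3 power3_eq_cube algebra_simps)
    then have "det A = 1"
      using \<theta> \<open>det A0 \<noteq> 0\<close> by simp
    moreover have "conj_transpose A ** hmat ** A = hmat"
    proof (subst vec_eq_iff, intro allI, subst vec_eq_iff, intro allI)
      fix i j
      have "(conj_transpose A ** hmat ** A) $ i $ j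
          = cnj \<theta> * \<theta> * (conj_transpose A0 ** hmat ** A0) $ i $ j"
        by (simp add: A_def matrix_matrix_mult_def conj_transpose_def sum_distrib_left
            sum_distrib_right mult_ac)
      then show "(conj_transpose A ** hmat ** A) $ i $ j = hmat $ i $ j"
        unfolding unit_\<theta> A0 by simp
    qed
    ultimately show ?thesis
      by (simp add: SU21_def)
  qed
  moreover have "A *v a i = \<theta> *s b i" for i
  proof -
    have A0Ma: "A0 ** Ma = Mb"
      by (simp add: A0_def N flip: matrix_mul_assoc)
    have "(A *v a i) $ j = \<theta> * (A0 ** Ma) $ j $ i" for j
      by (simp add: A_def Ma_def matrix_vector_mult_def matrix_matrix_mult_def sum_distrib_left mult_ac)
    then show ?thesis
      unfolding A0Ma by (simp add: Mb_def vec_eq_iff)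
  qed
  moreover have "\<theta> \<noteq> 0"
    using unit_\<theta> by auto
  ultimately show thesis
    using that by blast
qed

section \<open>Symmetrical configurations\<close>

definition diag3 :: "complex \<Rightarrow> complex \<Rightarrow> complex \<Rightarrow> complex^3^3" where
  "diag3 a b c = vector [vector [a, 0, 0], vector [0, b, 0], vector [0, 0, c]]"

lemma sums_componentwise:
  assumes "\<And>i. (\<lambda>n. f n $ i) sums (l $ i)"
  shows "f sums l"
  using assms unfolding sums_def by (intro vec_tendstoI) (simp add: sum_component)

lemma mat_exp_diag3: "mat_exp (diag3 a b c) = diag3 (exp a) (exp b) (exp c)"
proof -
  have power: "((**) (diag3 a b c) ^^ n) (mat 1) = diag3 (a^n) (b^n) (c^n)" for n
  proof (induction n)
    case 0
    show ?case
      by (simp add: vec_eq_iff forall_3 mat_def diag3_def)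
  next
    case (Suc n)
    then show ?case
      by (simp add: vec_eq_iff forall_3 diag3_def matrix_matrix_mult_def sum_3)
  qed
  have "(\<lambda>n. diag3 (a^n) (b^n) (c^n) /\<^sub>R fact n) sums diag3 (exp a) (exp b) (exp c)"
  proof (intro sums_componentwise)
    fix i j
    have "\<forall>i j. (\<lambda>n. (diag3 (a^n) (b^n) (c^n) /\<^sub>R fact n) $ i $ j) sums (diag3 (exp a) (exp b) (exp c) $ i $ j)"
      by (simp add: forall_3 diag3_def exp_converges)
    then show "(\<lambda>n. (diag3 (a^n) (b^n) (c^n) /\<^sub>R fact n) $ i $ j) sums (diag3 (exp a) (exp b) (exp c) $ i $ j)"
      by blast
  qed
  then show ?thesis
    unfolding mat_exp_def power by (rule sums_unique[symmetric])
qed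

lemma proj_act_proj: "proj_act M (proj z) = proj (M *v z)"
  by (auto simp: proj_act_def proj_def vec.span_singleton image_iff vector_scalar_commute)

lemma proj_smult:
  assumes "k \<noteq> 0"
  shows "proj (k *s z) = proj z"
proof -
  have "m *s z = (m / k) *s (k *s z)" for m
    using assms by simp
  then have "m *s z \<in> range (\<lambda>m. m *s (k *s z))" for m
    by blast
  moreover have "m *s (k *s z) \<in> range (\<lambda>m. m *s z)" for m
    by (metis rangeI vector_smult_assoc)
  ultimately show ?thesis
    unfolding proj_def vec.span_singleton by blast
qed

lemma matrix_inv_Umat:
  "matrix_inv Umat = vector [vector [1 / of_real (sqrt 2), 0, - \<i> / of_real (sqrt 2)],
     vector [0, 1, 0], vector [- \<i> / of_real (sqrt 2), 0, 1 / of_real (sqrt 2)]]" (is "_ = ?W")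
proof -
  have s: "complex_of_real (sqrt 2) * complex_of_real (sqrt 2) = 2"
    by (simp flip: of_real_mult)
  have 1: "Umat ** ?W = mat 1"
    by (simp add: vec_eq_iff forall_3 mat_def matrix_matrix_mult_def sum_3 Umat_def s)
  have 2: "?W ** Umat = mat 1"
    by (simp add: vec_eq_iff forall_3 mat_def matrix_matrix_mult_def sum_3 Umat_def s)
  have 3: "Umat ** matrix_inv Umat = mat 1"
    unfolding matrix_inv_def using 1 2 by (metis (mono_tags, lifting) someI_ex)
  have "(?W ** Umat) ** matrix_inv Umat = ?W ** (Umat ** matrix_inv Umat)"
    by (rule matrix_mul_assoc[symmetric])
  then show ?thesis
    unfolding 2 3 by (simp only: matrix_mul_lid matrix_mul_rid)
qed

text \<open>Expands the initial point in the columns of \<open>Umat\<close>, which are eigenvectors.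
  The third column is rescaled to \<open>(1, 0, - \<i>)\<close>, and only the component along
  \<open>(1, 0, \<i>)\<close> is timelike.\<close>

lemma symm_config1_eq:
  "symm_config1 r \<rho> s = proj (
     exp (- \<i> * e13 r \<rho> * s) *s (complex_of_real \<rho> *s vector [0, 1, 0])
   + exp (- \<i> * e12 r \<rho> * s) *s (complex_of_real ((2 + \<rho>^2) / 4) *s vector [1, 0, \<i>])
   + exp (- \<i> * e11 r \<rho> * s) *s (complex_of_real ((2 - \<rho>^2) / 4) *s vector [1, 0, - \<i>]))"
proof -
  have D: "s *\<^sub>R D1 r \<rho> = diag3 (- \<i> * e12 r \<rho> * s) (- \<i> * e13 r \<rho> * s) (- \<i> * e11 r \<rho> * s)"
    by (simp add: vec_eq_iff forall_3 D1_def diag3_def scaleR_conv_of_real[where 'a=complex])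
  have s: "complex_of_real (sqrt 2) * complex_of_real (sqrt 2) = 2"
    by (simp flip: of_real_mult)
  have s': "complex_of_real (sqrt 2) * (complex_of_real (sqrt 2) * u) = 2 * u" for u
    by (simp flip: of_real_mult mult.assoc)
  show ?thesis
    unfolding symm_config1_def S_point_def proj_act_proj D mat_exp_diag3 matrix_inv_Umat
    by (rule arg_cong[where f = proj])
      (simp add: vec_eq_iff forall_3 Umat_def diag3_def matrix_vector_mult_def matrix_matrix_mult_def
        sum_3 s s' field_simps power2_eq_square)
qed

section \<open>Recovering the parameters from eigenvalues and weights\<close>

lemma two_powr_two_thirds_cubed:
  assumes "(b::real) > 0"
  shows "(2 * b powr (2 / 3))^3 = 8 * b^2"
  using assms by (simp add: power_mult_distrib powr_power)

text \<open>Multiplying the quartic by \<open>u = 1 + 2 * r\<close> and completing the square gives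
  \<open>(u * \<rho>^2 + 6)^2 - 16 * S^2\<close>. The bound \<open>u * \<rho>^2 \<ge> - 6\<close>
  selects the branch of the square root, and dividing by the negative \<open>u\<close> reverses the
  inequality.\<close>

lemma region_AI:
  assumes "- 2 < r" "r < - 1 / 2" "0 < \<rho>" "\<rho> < sqrt 2"
    and N: "4 + 8 * r + 12 * \<rho>^2 + (1 + 2 * r) * \<rho>^4 < 0"
  shows "(r, \<rho>) \<in> region_A"
proof -
  define S where "S = sqrt (2 - r - r^2)"
  define u where "u = 1 + 2 * r"
  have u: "- 3 < u" "u < 0"
    using assms by (auto simp: u_def)
  have "0 \<le> (1 - r) * (r + 2)"
    using assms by (intro mult_nonneg_nonneg) auto
  then have S: "S^2 = 2 - r - r^2" "S \<ge> 0"
    by (auto simp: S_def power2_eq_square algebra_simps)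
  have \<rho>2: "\<rho>^2 < 2"
    using assms(3,4) by (metis real_sqrt_less_iff real_sqrt_abs abs_of_pos)
  have "0 < u * (4 + 8 * r + 12 * \<rho>^2 + (1 + 2 * r) * \<rho>^4)"
    using u N by (simp add: mult_neg_neg)
  also have "\<dots> = (u * \<rho>^2 + 6)^2 - (4 * S)^2"
    unfolding power_mult_distrib S u_def by algebra
  finally have "4 * S < \<bar>u * \<rho>^2 + 6\<bar>"
    using S(2) by (metis abs_le_square_iff abs_of_nonneg diff_gt_0_iff_gt linorder_not_le
        mult_nonneg_nonneg zero_le_numeral)
  moreover have "u * \<rho>^2 \<ge> - 3 * 2"
  proof -
    have "- u * \<rho>^2 \<le> 3 * 2"
      using u \<rho>2 by (intro mult_mono) auto
    then show ?thesis by simp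
  qed
  ultimately have "4 * S - 6 < u * \<rho>^2"
    by linarith
  then have "\<rho>^2 < 2 * (- 3 + 2 * S) / u"
    using u by (simp add: neg_less_divide_eq algebra_simps)
  then have "\<rho> < sqrt (2 * (- 3 + 2 * S) / u)"
    using real_less_rsqrt by blast
  then show ?thesis
    using assms by (simp add: region_A_def S_def u_def)
qed

text \<open>The weights of a curve in the eigenbasis determine \<open>\<rho>\<close> by the ratio of the two positive
  ones; the normalization of the parameter and of the frame determinant then fix the scale of the
  eigenvalues, which is what \<open>mu1\<close> encodes.\<close>

lemma e13_eqI:
  assumes r: "- 2 < r" "r < - 1 / 2" and \<rho>: "0 < \<rho>" "\<rho> < sqrt 2" and "e > 0" "K > 0"
    and N: "K * e * - (4 + 8 * r + 12 * \<rho>^2 + (1 + 2 * r) * \<rho>^4) = 8"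
    and B: "K^3 * ((2 + 3 * r - 3 * r^2 - 2 * r^3) * (- 4 * \<rho> + \<rho>^5))^2 * e^6 = 64"
  shows "(r, \<rho>) \<in> region_A" "e13 r \<rho> = e"
proof -
  let ?N = "4 + 8 * r + 12 * \<rho>^2 + (1 + 2 * r) * \<rho>^4"
  let ?B = "(2 + 3 * r - 3 * r^2 - 2 * r^3) * (- 4 * \<rho> + \<rho>^5)"
  have Nneg: "?N < 0"
  proof -
    have "0 < (K * e) * - ?N"
      using N by linarith
    then show ?thesis
      using zero_less_mult_pos[of "K * e" "- ?N"] \<open>e > 0\<close> \<open>K > 0\<close> by simp
  qed
  with region_AI r \<rho> show "(r, \<rho>) \<in> region_A"
    by blast
  have \<rho>2: "\<rho>^2 < 2"
    using \<rho> by (metis real_sqrt_less_iff real_sqrt_abs abs_of_pos)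
  \<comment> \<open>All factors are positive in the given range, so the base of \<open>powr\<close>
    in \<open>mu1\<close> is positive and the power can be cubed.\<close>
  have "?B = (1 - r) * (r + 2) * - (1 + 2 * r) * \<rho> * (2 + \<rho>^2) * (2 - \<rho>^2)"
    by algebra
  then have Bpos: "?B > 0"
    using r \<rho> \<rho>2 by (simp only:) (intro mult_pos_pos; simp add: add_pos_nonneg)
  define P where "P = 2 * ?B powr (2 / 3)"
  have "P > 0"
    unfolding P_def using Bpos by (simp only: powr_gt_zero zero_less_mult_iff[of 2]) auto
  have "P^3 = 8 * ?B^2"
    unfolding P_def by (rule two_powr_two_thirds_cubed[OF Bpos])
  \<comment> \<open>Cubing \<open>N\<close> and comparing with \<open>B\<close> eliminates
    \<open>K\<close>; taking real cube roots afterwards gives \<open>P * e = - ?N\<close>.\<close>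
  moreover have "8 * ?B^2 * e^3 = (- ?N)^3"
  proof -
    have "(K * e)^3 * (8 * ?B^2 * e^3) = 8 * (K^3 * ?B^2 * e^6)"
      by algebra
    also have "\<dots> = (K * e * - ?N)^3"
      unfolding B N by simp
    also have "\<dots> = (K * e)^3 * (- ?N)^3"
      by (rule power_mult_distrib)
    finally show ?thesis
      using \<open>e > 0\<close> \<open>K > 0\<close> by (simp only: mult_cancel_left) auto
  qed
  ultimately have "(P * e)^3 = (- ?N)^3"
    by (simp only: power_mult_distrib)
  then have "P * e = - ?N"
    using \<open>P > 0\<close> \<open>e > 0\<close> Nneg by (intro power_eq_imp_eq_base[of "P * e" 3]) auto
  then have e: "e = - ?N / P"
    using \<open>P > 0\<close> by (simp add: field_simps)
  have \<mu>: "mu1 r \<rho> = ?N / (?N - P)"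
    by (simp add: mu1_def P_def)
  have quotient: "n / (n - P) / (1 - n / (n - P)) = - n / P" if "n < 0" for n
    using that \<open>P > 0\<close> by (simp add: divide_simps)
  have "e13 r \<rho> = ?N / (?N - P) / (1 - ?N / (?N - P))"
    by (simp only: e13_def \<mu>)
  also have "\<dots> = e"
    unfolding quotient[OF Nneg] e ..
  finally show "e13 r \<rho> = e" .
qed

text \<open>Here \<open>a\<close> is \<open>2 * \<kappa>\<close>. Three relations drive the proof:
  the weights sum to zero (nullity), their first moment is 1 (natural parameter), and their product
  times the discriminant is -1 (frame determinant). The first is solved by \<open>\<rho>\<close> and
  \<open>K\<close>; the others become the hypotheses \<open>N\<close> and \<open>B\<close> of
  \<open>e13_eqI\<close>.\<close>

lemma weights_parameters:
  fixes x y z a :: real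
  assumes sorted: "x < y" "y < z" and sum: "x + y + z = 0"
    and a: "a + x > 0" "(a + x) * (a + y) * (a + z) = 1"
  defines "n1 \<equiv> (a + x) / ((x - y) * (x - z))" and "n2 \<equiv> (a + y) / ((y - x) * (y - z))"
    and "n3 \<equiv> (a + z) / ((z - x) * (z - y))"
  obtains \<rho> K where "K > 0" "n1 = K * \<rho>^2" "n2 = - K * (2 + \<rho>^2)^2 / 8"
    "n3 = K * (2 - \<rho>^2)^2 / 8" "(z / x, \<rho>) \<in> region_A"
    "e11 (z / x) \<rho> = - z" "e12 (z / x) \<rho> = - y" "e13 (z / x) \<rho> = - x"
proof -
  have n_sum: "n1 + n2 + n3 = 0" and n_moment: "x * n1 + y * n2 + z * n3 = 1"
  proof -
    \<comment> \<open>Positive gaps make every denominator visibly nonzero.\<close>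
    define p q where "p = y - x" and "q = z - y"
    have pq: "p > 0" "q > 0" "y = x + p" "z = x + p + q"
      using sorted by (auto simp: p_def q_def)
    have "x - y = - p" "x - z = - (p + q)" "y - x = p" "y - z = - q" "z - x = p + q" "z - y = q"
      using pq by auto
    then have n: "n1 = (a + x) / (- p * - (p + q))" "n2 = (a + (x + p)) / (p * - q)"
      "n3 = (a + (x + p + q)) / ((p + q) * q)"
      unfolding n1_def n2_def n3_def by (simp_all only: pq(3,4))
    show "n1 + n2 + n3 = 0"
      using pq(1,2) unfolding n by (simp add: divide_simps) algebra
    show "x * n1 + y * n2 + z * n3 = 1"
      using pq(1,2) unfolding n pq(3,4) by (simp add: divide_simps) algebra
  qed
  have n1: "n1 > 0" and n2: "n2 < 0" and n3: "n3 > 0"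
    using sorted a(1) by (auto simp: n1_def n2_def n3_def zero_less_divide_iff
        divide_less_0_iff zero_less_mult_iff mult_less_0_iff)
  have n_prod: "n1 * n2 * n3 * ((x - y) * (x - z) * (y - z))^2 = - 1"
  proof -
    have "n1 * n2 * n3 = 1 / (((x - y) * (x - z)) * ((y - x) * (y - z)) * ((z - x) * (z - y)))"
      unfolding n1_def n2_def n3_def using a(2) by (simp add: divide_simps)
    also have "((x - y) * (x - z)) * ((y - x) * (y - z)) * ((z - x) * (z - y))
        = - (((x - y) * (x - z) * (y - z))^2)"
      by algebra
    finally show ?thesis
      using sorted by simp
  qed
  \<comment> \<open>\<open>e\<close> is the intended \<open>e13\<close>. The sign is reversed
    because the configurations rotate by \<open>exp (- \<i> * e * s)\<close>.\<close>
  define r e where "r = z / x" and "e = - x"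
  have "x < 0"
    using sorted sum by linarith
  then have "e > 0" and x: "x = - e" and z: "z = - r * e" and y: "y = (1 + r) * e"
    using sum by (auto simp: r_def e_def algebra_simps)
  have r: "- 2 < r" "r < - 1 / 2"
  proof -
    have "0 < (2 + r) * e" "0 < - (1 + 2 * r) * e"
      using sorted unfolding x y z by (auto simp: algebra_simps)
    then show "- 2 < r" "r < - 1 / 2"
      using \<open>e > 0\<close> by (auto simp: zero_less_mult_iff)
  qed
  \<comment> \<open>\<open>q\<close> must equal \<open>(2 - \<rho>^2) / (2 + \<rho>^2)\<close>;
    solving for \<open>\<rho>\<close> and then for \<open>K\<close> in the formula for
    \<open>n2\<close> yields the next two definitions. That \<open>q < 1\<close> follows from
    \<open>n1 > 0\<close> and the zero sum.\<close>
  define q where "q = sqrt (n3 / - n2)"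
  have q2: "n3 = - n2 * q^2" and "0 < q" "q < 1"
    using n1 n2 n3 n_sum by (auto simp: q_def field_simps)
  define \<rho> where "\<rho> = sqrt (2 * (1 - q) / (1 + q))"
  define K where "K = - n2 * (1 + q)^2 / 2"
  have \<rho>2: "\<rho>^2 = 2 * (1 - q) / (1 + q)"
    unfolding \<rho>_def using \<open>0 < q\<close> \<open>q < 1\<close> by (intro real_sqrt_pow2) auto
  have "\<rho> > 0" "\<rho> < sqrt 2"
    using \<open>0 < q\<close> \<open>q < 1\<close> by (auto simp: \<rho>_def field_simps)
  have "K > 0"
    using n2 \<open>0 < q\<close> by (simp add: K_def mult_neg_pos)
  have "2 + \<rho>^2 = 4 / (1 + q)" and "2 - \<rho>^2 = 4 * q / (1 + q)"
    unfolding \<rho>2 using \<open>0 < q\<close> by (auto simp: field_simps)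
  then have n2': "n2 = - K * (2 + \<rho>^2)^2 / 8" and n3': "n3 = K * (2 - \<rho>^2)^2 / 8"
    unfolding q2 K_def using \<open>0 < q\<close> by (simp_all add: power_divide power_mult_distrib)
  have n1': "n1 = K * \<rho>^2"
  proof -
    have "n1 = - n2 - n3"
      using n_sum by simp
    also have "\<dots> = K * \<rho>^2"
      unfolding n2' n3' by algebra
    finally show ?thesis .
  qed
  have N: "K * e * - (4 + 8 * r + 12 * \<rho>^2 + (1 + 2 * r) * \<rho>^4) = 8"
    using n_moment unfolding n1' n2' n3' x y z by algebra
  have B: "K^3 * ((2 + 3 * r - 3 * r^2 - 2 * r^3) * (- 4 * \<rho> + \<rho>^5))^2 * e^6 = 64"
    using n_prod unfolding n1' n2' n3' x y z by algebra
  note * = e13_eqI[OF r \<open>\<rho> > 0\<close> \<open>\<rho> < sqrt 2\<close> \<open>e > 0\<close> \<open>K > 0\<close> N B]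
  show thesis
  proof (rule that[OF \<open>K > 0\<close> n1' n2' n3', folded r_def])
    show "(r, \<rho>) \<in> region_A" "e13 r \<rho> = - x"
      using * by (auto simp: e_def)
    have "e11 r \<rho> = r * e13 r \<rho>" "e12 r \<rho> = - (1 + r) * e13 r \<rho>"
      by (simp_all add: e11_def e12_def e13_def)
    then show "e11 r \<rho> = - z" "e12 r \<rho> = - y"
      unfolding *(2) y z by (simp_all add: algebra_simps)
  qed
qed

section \<open>Matching the two eigenbases\<close>

theorem proposition4p11:
  fixes \<gamma> :: "real \<Rightarrow> proj_point"
  assumes "first_class_string \<gamma>"
  shows "\<exists>A\<in>SU21. \<exists>r \<rho> s0. (r, \<rho>) \<in> region_A \<and> r \<in> \<rat> \<and>
           (\<forall>s. proj_act A (\<gamma> s) = symm_config1 r \<rho> (s + s0))"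
proof -
  obtain \<kappa> \<tau> where string: "isoparametric_string \<gamma> \<kappa> \<tau>" and first: "sqrt \<bar>\<tau>\<bar> < 3 * \<kappa>"
    using assms by (auto simp: first_class_string_def)
  obtain \<Gamma> where nat: "natural_lift \<gamma> \<Gamma>" and bt: "\<And>s. bending \<Gamma> s = \<kappa>" "\<And>s. twist \<Gamma> s = \<tau>"
    using string by (auto simp: isoparametric_string_def isoparametric_def)
  obtain \<omega> where \<omega>: "\<omega> > 0" "\<And>s. \<gamma> (s + \<omega>) = \<gamma> s"
    using string by (auto simp: isoparametric_string_def closed_curve_def)
  have lift: "lift_of \<gamma> \<Gamma>" and \<gamma>: "\<gamma> s = proj (\<Gamma> s)" for s
    using nat by (auto simp: natural_lift_def wilczynski_lift_def lift_of_def)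
  interpret natural_isoparametric \<Gamma> \<kappa> \<tau>
  proof
    fix s
    have "\<i> * inverse (herm (\<Gamma> s) (dds \<Gamma> s)) = 1"
      using nat by (simp add: natural_lift_def)
    then show "herm (\<Gamma> s) (dds \<Gamma> s) = \<i>"
      by (simp add: divide_eq_1_iff flip: divide_inverse)
    show "det3 (\<Gamma> s) (dds \<Gamma> s) (dds (dds \<Gamma>) s) = - 1"
      using nat by (simp add: natural_lift_def wilczynski_lift_def frame_det_def det3_def)
    show "smooth \<Gamma>" "herm (\<Gamma> s) (\<Gamma> s) = 0"
      using lift by (simp_all add: lift_of_def null_cone_def)
    show "bending \<Gamma> s = \<kappa>" "twist \<Gamma> s = \<tau>"
      by (fact bt)+
  qed
  obtain k where k: "norm k = 1" "\<And>s. \<Gamma> (s + \<omega>) = k *s \<Gamma> s"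
    using monodromy[of \<omega>] \<omega>(2) unfolding \<gamma> by metis
  interpret closed_natural_isoparametric \<Gamma> \<kappa> \<tau> \<omega> k
    by unfold_locales (fact \<omega>(1) k)+
  obtain x y z where e: "eigenvalue_triple x y z" and sorted: "x < y" "y < z"
    using eigenvalue_triple_sorted .
  have perms: "eigenvalue_triple x z y" "eigenvalue_triple y x z" "eigenvalue_triple y z x"
    "eigenvalue_triple z x y" "eigenvalue_triple z y x"
    using e by (simp_all add: eigenvalue_triple_def algebra_simps)
  have sum: "x + y + z = 0"
    using e by (simp add: eigenvalue_triple_def)
  obtain \<rho> K where "K > 0"
    and n1: "(2 * \<kappa> + x) / ((x - y) * (x - z)) = K * \<rho>^2"
    and n2: "(2 * \<kappa> + y) / ((y - x) * (y - z)) = - K * (2 + \<rho>^2)^2 / 8"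
    and n3: "(2 * \<kappa> + z) / ((z - x) * (z - y)) = K * (2 - \<rho>^2)^2 / 8"
    and region: "(z / x, \<rho>) \<in> region_A"
    and eigenvalues: "e11 (z / x) \<rho> = - z" "e12 (z / x) \<rho> = - y" "e13 (z / x) \<rho> = - x"
    using weights_parameters[OF sorted sum first_class_eigenvalue_bound[OF e sorted first]] .
  define a :: "3 \<Rightarrow> complex^3" where "a j = vector [v x y z, v y x z, v z x y] $ j" for j
  \<comment> \<open>Eigenvectors of the model, listed in the order of \<open>x\<close>,
    \<open>y\<close>, \<open>z\<close>; the factor \<open>sqrt K\<close> gives them the same Gram
    matrix as \<open>a\<close>.\<close>
  define b :: "3 \<Rightarrow> complex^3" where
    "b j = complex_of_real (sqrt K) *s (vector [complex_of_real \<rho> *s vector [0, 1, 0],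
      complex_of_real ((2 + \<rho>^2) / 4) *s vector [1, 0, \<i>],
      complex_of_real ((2 - \<rho>^2) / 4) *s vector [1, 0, - \<i>]] $ j)" for j
  have a: "a 1 = v x y z" "a 2 = v y x z" "a 3 = v z x y"
    by (simp_all add: a_def)
  have b: "b 1 = complex_of_real (sqrt K) *s (complex_of_real \<rho> *s vector [0, 1, 0])"
    "b 2 = complex_of_real (sqrt K) *s (complex_of_real ((2 + \<rho>^2) / 4) *s vector [1, 0, \<i>])"
    "b 3 = complex_of_real (sqrt K) *s (complex_of_real ((2 - \<rho>^2) / 4) *s vector [1, 0, - \<i>])"
    by (simp_all only: b_def vector_3)
  have gram_a: "herm (a i) (a j) = (if i = j then complex_of_real
      (vector [K * \<rho>^2, - K * (2 + \<rho>^2)^2 / 8, K * (2 - \<rho>^2)^2 / 8] $ i) else 0)" for i j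
  proof -
    have "\<forall>i j. herm (a i) (a j) = (if i = j then complex_of_real
      (vector [K * \<rho>^2, - K * (2 + \<rho>^2)^2 / 8, K * (2 - \<rho>^2)^2 / 8] $ i) else 0)"
      unfolding forall_3 a herm_v_self[OF e perms(2,1)] herm_v_self[OF perms(2) e perms(3)]
        herm_v_self[OF perms(4,1,5)] n1 n2 n3
        herm_v_orthogonal[OF e] herm_v_orthogonal[OF perms(1)] herm_v_orthogonal[OF perms(2)]
        herm_v_orthogonal[OF perms(3)] herm_v_orthogonal[OF perms(4)] herm_v_orthogonal[OF perms(5)]
      by simp
    then show ?thesis
      by blast
  qed
  have gram_b: "herm (b i) (b j) = (if i = j then complex_of_real
      (vector [K * \<rho>^2, - K * (2 + \<rho>^2)^2 / 8, K * (2 - \<rho>^2)^2 / 8] $ i) else 0)" for i j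
  proof -
    have K: "complex_of_real (sqrt K) * complex_of_real (sqrt K) = of_real K"
      using \<open>K > 0\<close> by (simp flip: of_real_mult)
    have scaled: "\<forall>i j. herm (b i) (b j) = complex_of_real (sqrt K) * complex_of_real (sqrt K)
        * (if i = j then complex_of_real (vector [\<rho>^2, - ((2 + \<rho>^2)^2) / 8, (2 - \<rho>^2)^2 / 8] $ i) else 0)"
      unfolding b_def herm_simps by (simp add: forall_3 herm_expand power2_eq_square)
    have "\<forall>i::3. complex_of_real K * complex_of_real (vector [\<rho>^2, - ((2 + \<rho>^2)^2) / 8, (2 - \<rho>^2)^2 / 8] $ i)
        = complex_of_real (vector [K * \<rho>^2, - K * (2 + \<rho>^2)^2 / 8, K * (2 - \<rho>^2)^2 / 8] $ i)"
      by (simp add: forall_3)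
    then show ?thesis
      using scaled unfolding K by (cases "i = j") simp_all
  qed
  have ne: "\<rho> \<noteq> 0" "2 + \<rho>^2 \<noteq> 0" "2 - \<rho>^2 \<noteq> 0"
  proof -
    have "0 < \<rho>" "\<rho> < sqrt 2"
      using region by (auto simp: region_A_def)
    then have "\<rho>^2 < 2"
      by (metis real_sqrt_less_iff real_sqrt_abs abs_of_pos)
    then show "\<rho> \<noteq> 0" "2 + \<rho>^2 \<noteq> 0" "2 - \<rho>^2 \<noteq> 0"
      using \<open>0 < \<rho>\<close> zero_le_power2[of \<rho>] by linarith+
  qed
  have "det (\<chi> i j. herm (a i) (a j))
      = complex_of_real ((K * \<rho>^2) * (- K * (2 + \<rho>^2)^2 / 8) * (K * (2 - \<rho>^2)^2 / 8))"
    unfolding gram_a by (simp add: det_3)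
  also have "\<dots> \<noteq> 0"
    unfolding of_real_eq_0_iff using ne \<open>K > 0\<close> by simp
  finally have nondegenerate: "det (\<chi> i j. herm (a i) (a j)) \<noteq> 0" .
  have gram: "herm (a i) (a j) = herm (b i) (b j)" for i j
    unfolding gram_a gram_b ..
  obtain A \<theta> where A: "A \<in> SU21" "\<theta> \<noteq> 0" "\<And>i. A *v a i = \<theta> *s b i"
    by (rule SU21_of_gram_eq[OF gram nondegenerate]) (rule that)
  \<comment> \<open>The eigenvalues match exactly and the phases at \<open>s = 0\<close> are
    absorbed in \<open>A\<close>, so the shift 0 works. The common factor
    \<open>\<theta> * sqrt K\<close> disappears projectively.\<close>
  have "proj_act A (\<gamma> s) = symm_config1 (z / x) \<rho> (s + 0)" for s
  proof -
    have "A *v \<Gamma> s = (\<theta> * complex_of_real (sqrt K)) *s (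
       exp (\<i> * x * s) *s (complex_of_real \<rho> *s vector [0, 1, 0])
     + exp (\<i> * y * s) *s (complex_of_real ((2 + \<rho>^2) / 4) *s vector [1, 0, \<i>])
     + exp (\<i> * z * s) *s (complex_of_real ((2 - \<rho>^2) / 4) *s vector [1, 0, - \<i>]))"
      unfolding decomposition[OF e perms(2,4), of s] a[symmetric] matrix_vector_right_distrib
        vector_scalar_commute A(3)
      by (simp only: b vector_add_ldistrib vector_smult_assoc mult_ac)
    moreover have "\<theta> * complex_of_real (sqrt K) \<noteq> 0"
      using \<open>K > 0\<close> A(2) by simp
    ultimately show ?thesis
      unfolding \<gamma> proj_act_proj symm_config1_eq eigenvalues
      by (simp only: proj_smult of_real_minus minus_mult_minus add_0_right not_False_eq_True)
  qed
  with region eigenvalue_ratio_rational[OF e] show ?thesis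
    by (intro bexI[OF _ A(1)] exI[of _ "z / x"] exI[of _ \<rho>] exI[of _ "0::real"] conjI allI)
qed

end
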